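(* Let $m,r$ be integers such that either $m>0$ and $r>0$, or $m=0$ and $r\ge0$. Then for every integer $n\ge 1$, $$h(n,m,\le -r)=h(n-r-2m-2,\;m+2,\;\ge -r),$$ where $h(n,m,\le r)$ and $h(n,m,\ge r)$ denote the numbers of partitions $\lambda$ of $n$ whose $(2,m)$-rank $r_{2,m}(\lambda)$ is defined and satisfies $r_{2,m}(\lambda)\le r$, respectively $r_{2,m}(\lambda)\ge r$.
   Context: A partition $\lambda$ of $n$ is a finite sequence $\lambda_1\ge\dots\ge\lambda_{\ell(\lambda)}>0$ of integers with sum $n$; put $\lambda_j=0$ for $j>\ell(\lambda)$. There is one (empty) partition of $0$ and there are none of a negative integer. The Young diagram $[\lambda]$ has rows of lengths $\lambda_1,\lambda_2,\dots$ from top to bottom. The conjugate partition is denoted $\lambda'$. Let $e(\lambda)=\lambda_{\ell(\lambda)}$ be the smallest part. $\lambda$ is a Rogers-Ramanujan partition if $e(\lambda)\ge\ell(\lambda)$ (the empty partition is counted as Rogers-Ramanujan). Let $\mathcal P$ be the set of all partitions and $\mathcal Q$ the set of Rogers-Ramanujan partitions. For $m\ge 0$, an $m$-rectangle is a rectangle whose height minus its width is $m$. Width $0$ is allowed (such a rectangle always fits, even in the empty diagram) but height $0$ is never allowed. The first $m$-Durfee rectangle of $\lambda$ is the largest $m$-rectangle which fits in $[\lambda]$ (in its top left corner); its height is $s=s_m(\lambda)$. The second $m$-Durfee rectangle is the largest $m$-rectangle which fits in $[\lambda]$ (left-justified) directly below the first; its height is $t=t_m(\lambda)$. Explicitly,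 $s$ is the largest integer $\ge\max(m,1)$ such that $s=m$ or $\lambda_s\ge s-m$, and $t$ is the largest integer $\ge\max(m,1)$ such that $t=m$ or $\lambda_{s+t}\ge t-m$. For $m>0$ both always exist; for $m=0$ both exist exactly when $\lambda\in\mathcal P\smallsetminus\mathcal Q$. Let $\alpha,\beta,\gamma$ be the partitions to the right of the first, to the right of the second (in the middle), and below the second $m$-Durfee rectangle: $\alpha_i=\lambda_i-(s-m)$ for $1\le i\le s$, $\beta_i=\lambda_{s+i}-(t-m)$ for $1\le i\le t$, $\gamma_i=\lambda_{s+t+i}$ for $i\ge 1$ (parts outside these ranges are $0$). The $(2,m)$-rank of $\lambda$ is $$r_{2,m}(\lambda)=\beta_1+\alpha_{s-t-\beta_1+1}-\gamma_1',$$ where $\gamma'_1$ is the number of (nonzero) parts of $\gamma$. It is defined for all $\lambda\in\mathcal P$ if $m>0$, and only for $\lambda\in\mathcal P\smallsetminus\mathcal Q$ if $m=0$. In particular, for $m>0$ the empty partition has $(2,m)$-rank $0$. *)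

theory Defs
  imports Main
begin

text \<open>A partition is the list of its parts in weakly decreasing order.\<close>

definition is_partition :: "nat list \<Rightarrow> bool" where
  "is_partition l \<longleftrightarrow> sorted_wrt (\<ge>) l \<and> (\<forall>x\<in>set l. 0 < x)"

text \<open>The size is an integer, so that there are no partitions of a negative number.\<close>

definition partitions_of :: "int \<Rightarrow> nat list set" where
  "partitions_of n = {l. is_partition l \<and> int (sum_list l) = n}"

text \<open>Parts are numbered from 1, and are 0 beyond the length.\<close>

definition part :: "nat list \<Rightarrow> nat \<Rightarrow> nat" where
  "part l j = (if 1 \<le> j \<and> j \<le> length l then l ! (j - 1) else 0)"

definition rogers_ramanujan :: "nat list \<Rightarrow> bool" where
  "rogers_ramanujan l \<longleftrightarrow> l = [] \<or> last l \<ge> length l"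

text \<open>Heights of the first and second \<open>m\<close>-Durfee rectangles. The maxima exist whenever
  \<open>rank_defined m l\<close> holds, see \<open>durfee1_props\<close> and \<open>durfee2_props\<close> below.\<close>

definition durfee1 :: "nat \<Rightarrow> nat list \<Rightarrow> nat" where
  "durfee1 m l = (GREATEST s. max m 1 \<le> s \<and> (s = m \<or> part l s \<ge> s - m))"

definition durfee2 :: "nat \<Rightarrow> nat list \<Rightarrow> nat" where
  "durfee2 m l =
     (GREATEST t. max m 1 \<le> t \<and> (t = m \<or> part l (durfee1 m l + t) \<ge> t - m))"

definition alpha :: "nat \<Rightarrow> nat list \<Rightarrow> nat \<Rightarrow> nat" where
  "alpha m l i =
     (if 1 \<le> i \<and> i \<le> durfee1 m l then part l i - (durfee1 m l - m) else 0)"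

definition beta :: "nat \<Rightarrow> nat list \<Rightarrow> nat \<Rightarrow> nat" where
  "beta m l i =
     (if 1 \<le> i \<and> i \<le> durfee2 m l
      then part l (durfee1 m l + i) - (durfee2 m l - m) else 0)"

definition gamma :: "nat \<Rightarrow> nat list \<Rightarrow> nat \<Rightarrow> nat" where
  "gamma m l i = (if 1 \<le> i then part l (durfee1 m l + durfee2 m l + i) else 0)"

definition rank_defined :: "nat \<Rightarrow> nat list \<Rightarrow> bool" where
  "rank_defined m l \<longleftrightarrow> m > 0 \<or> \<not> rogers_ramanujan l"

text \<open>The cardinality is \<open>\<gamma>'\<^sub>1\<close>, the number of nonzero parts of \<open>\<gamma>\<close>. None of the
  subtractions on natural numbers, here and in \<open>alpha\<close> and \<open>beta\<close>, truncates on a partition with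
  defined rank; see \<open>alpha_exact\<close>, \<open>beta_exact\<close> and \<open>rank_index_exact\<close>.\<close>

definition rank2 :: "nat \<Rightarrow> nat list \<Rightarrow> int" where
  "rank2 m l =
     int (beta m l 1)
     + int (alpha m l (durfee1 m l - durfee2 m l - beta m l 1 + 1))
     - int (card {i. gamma m l i \<noteq> 0})"

definition h_le :: "int \<Rightarrow> nat \<Rightarrow> int \<Rightarrow> nat" where
  "h_le n m r = card {l \<in> partitions_of n. rank_defined m l \<and> rank2 m l \<le> r}"

definition h_ge :: "int \<Rightarrow> nat \<Rightarrow> int \<Rightarrow> nat" where
  "h_ge n m r = card {l \<in> partitions_of n. rank_defined m l \<and> rank2 m l \<ge> r}"

lemma finite_partitions_of: "finite (partitions_of n)"
proof (rule finite_subset)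
  have len: "length l \<le> sum_list l" if "\<forall>x\<in>set l. 0 < x" for l :: "nat list"
    using that by (induction l) auto
  show "partitions_of n \<subseteq> {l. set l \<subseteq> {..nat n} \<and> length l \<le> nat n}"
    using len member_le_sum_list by (fastforce simp: partitions_of_def is_partition_def)
  show "finite {l. set l \<subseteq> {..nat n} \<and> length l \<le> nat n}"
    by (rule finite_lists_length_le) simp
qed

lemma part_antimono:
  assumes "is_partition l" "1 \<le> i" "i \<le> j"
  shows "part l j \<le> part l i"
proof (cases "i = j \<or> j > length l")
  case True
  then show ?thesis by (auto simp: part_def)
next
  case False
  with assms have "l ! (j - 1) \<le> l ! (i - 1)"
    by (auto simp: is_partition_def intro!: sorted_wrt_nth_less[where P = "(\<ge>)"])
  with False assms show ?thesis by (auto simp: part_def)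
qed

lemma durfee1_bound:
  "max m 1 \<le> s \<and> (s = m \<or> part l s \<ge> s - m) \<Longrightarrow> s \<le> m + length l"
  by (auto simp: part_def split: if_splits)

lemma durfee2_bound:
  "max m 1 \<le> t \<and> (t = m \<or> part l (s + t) \<ge> t - m) \<Longrightarrow> t \<le> m + length l"
  by (auto simp: part_def split: if_splits)

lemma durfee1_props:
  assumes "is_partition l" "rank_defined m l"
  shows "max m 1 \<le> durfee1 m l \<and> (durfee1 m l = m \<or> part l (durfee1 m l) \<ge> durfee1 m l - m)"
  unfolding durfee1_def
proof (rule GreatestI_nat[where P = "\<lambda>s. max m 1 \<le> s \<and> (s = m \<or> part l s \<ge> s - m)"
      and k = "max m 1" and b = "m + length l"])
  have "part l 1 \<ge> 1" if "m = 0"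
    using assms that
    by (cases l) (auto simp: rank_defined_def rogers_ramanujan_def is_partition_def part_def)
  then show "max m 1 \<le> max m 1 \<and> (max m 1 = m \<or> part l (max m 1) \<ge> max m 1 - m)"
    by (cases "m = 0") auto
qed (rule durfee1_bound)

lemma durfee2_props:
  assumes "is_partition l" "rank_defined m l"
  shows "max m 1 \<le> durfee2 m l \<and>
    (durfee2 m l = m \<or> part l (durfee1 m l + durfee2 m l) \<ge> durfee2 m l - m)"
  unfolding durfee2_def
proof (rule GreatestI_nat[where
      P = "\<lambda>t. max m 1 \<le> t \<and> (t = m \<or> part l (durfee1 m l + t) \<ge> t - m)"
      and k = "max m 1" and b = "m + length l"])
  let ?s = "durfee1 m l"
  have "part l (?s + 1) \<ge> 1" if m: "m = 0"
  proof -
    have s: "1 \<le> ?s" "?s \<le> part l ?s"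
      using durfee1_props[OF assms] m by auto
    have "?s < length l"
    proof (rule ccontr)
      assume "\<not> ?s < length l"
      with s have "?s = length l" "l \<noteq> []" by (auto simp: part_def split: if_splits)
      with s have "rogers_ramanujan l"
        by (auto simp: part_def rogers_ramanujan_def last_conv_nth split: if_splits)
      with assms m show False by (simp add: rank_defined_def)
    qed
    then have "l ! ?s > 0" using assms by (simp add: is_partition_def)
    with \<open>?s < length l\<close> show ?thesis by (simp add: part_def)
  qed
  then show "max m 1 \<le> max m 1 \<and>
      (max m 1 = m \<or> part l (?s + max m 1) \<ge> max m 1 - m)"
    by (cases "m = 0") auto
qed (rule durfee2_bound)

lemma alpha_exact:
  assumes "is_partition l" "rank_defined m l" "1 \<le> i" "i \<le> durfee1 m l"
  shows "m \<le> durfee1 m l" "durfee1 m l - m \<le> part l i"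
  using durfee1_props[OF assms(1,2)] part_antimono[OF assms(1,3,4)] by auto

lemma beta_exact:
  assumes "is_partition l" "rank_defined m l" "1 \<le> i" "i \<le> durfee2 m l"
  shows "m \<le> durfee2 m l" "durfee2 m l - m \<le> part l (durfee1 m l + i)"
  using durfee2_props[OF assms(1,2)] assms(3,4)
    part_antimono[OF assms(1), of "durfee1 m l + i" "durfee1 m l + durfee2 m l"] by auto

lemma rank_index_exact:
  assumes "is_partition l" "rank_defined m l"
  shows "durfee2 m l + beta m l 1 \<le> durfee1 m l"
proof -
  let ?s = "durfee1 m l" and ?t = "durfee2 m l"
  have s: "m \<le> ?s" and t: "m \<le> ?t" "1 \<le> ?t"
    using durfee1_props[OF assms] durfee2_props[OF assms] by auto
  have "\<not> (max m 1 \<le> ?s + 1 \<and> (?s + 1 = m \<or> part l (?s + 1) \<ge> ?s + 1 - m))"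
  proof
    assume "max m 1 \<le> ?s + 1 \<and> (?s + 1 = m \<or> part l (?s + 1) \<ge> ?s + 1 - m)"
    then have "?s + 1 \<le> (GREATEST s. max m 1 \<le> s \<and> (s = m \<or> part l s \<ge> s - m))"
      by (rule Greatest_le_nat) (rule durfee1_bound)
    then show False by (simp add: durfee1_def)
  qed
  then have "part l (?s + 1) \<le> ?s - m" using s by auto
  moreover have "?t - m \<le> part l (?s + 1)" using beta_exact[OF assms _ t(2)] by simp
  ultimately show ?thesis using s t by (auto simp: beta_def)
qed

end

theory Submission
  imports Defs
begin

text \<open>Boulet and Pak's bijection. Given a partition with \<open>(2,m)\<close>-rank at most \<open>-r\<close>, remove the first
  column of \<open>\<gamma>\<close>, split its height minus \<open>r\<close> into two parts, and insert one as a part of \<open>\<alpha>\<close> and one as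
  the largest part of \<open>\<beta>\<close>, while both Durfee rectangles become one taller and one narrower. There
  is exactly one way to split such that the rank can see the two inserted parts: they are the two
  terms \<open>\<beta>\<^sub>1\<close> and \<open>\<alpha>\<close> at position \<open>s - t - \<beta>\<^sub>1 + 1\<close> of the new \<open>(2,m+2)\<close>-rank. The new rank is thus
  \<open>\<gamma>'\<^sub>1 - r - \<gamma>'\<^sub>2\<close>, which is at least \<open>-r\<close>. The inverse involves no choice: delete
  these two parts and add a column whose height is their sum plus \<open>r\<close>.\<close>

abbreviation decreasing :: "nat list \<Rightarrow> bool" where
  "decreasing \<equiv> sorted_wrt (\<ge>)"

section \<open>Partitions and zero parts\<close>

lemma part_nth: "i < length u \<Longrightarrow> part u (Suc i) = u ! i"
  by (simp add: part_def)

lemma part_Cons: "part (x # u) j = (if j = 0 then 0 else if j = 1 then x else part u (j - 1))"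
  by (cases j) (auto simp: part_def nth_Cons split: nat.splits)

text \<open>The zeros of a decreasing list form its tail, so dropping them moves no positive entry,
  and \<open>part\<close> returns 0 past the end anyway.\<close>

lemma part_filter_pos: "decreasing u \<Longrightarrow> part (filter ((<) 0) u) j = part u j"
proof (induction u arbitrary: j)
  case (Cons x u)
  show ?case
  proof (cases "x = 0")
    case True
    with Cons.prems have zero: "\<forall>y\<in>set (x # u). y = 0" by auto
    then have "part (x # u) j = 0"
      unfolding part_def by (metis diff_less le_trans less_le_trans nth_mem zero_less_one diff_Suc_less Suc_le_eq One_nat_def)
    moreover have "filter ((<) 0) (x # u) = []"
      using zero by (auto simp: filter_empty_conv)
    ultimately show ?thesis by (simp add: part_def)
  next
    case False
    with Cons show ?thesis by (simp add: part_Cons)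
  qed
qed simp

lemma is_partition_filter_pos: "decreasing u \<Longrightarrow> is_partition (filter ((<) 0) u)"
  by (auto simp: is_partition_def sorted_wrt_filter)

lemma sum_list_filter_pos: "sum_list (filter ((<) 0) u) = sum_list (u :: nat list)"
  by (induction u) auto

lemma decreasing_iff_nth: "decreasing u \<longleftrightarrow> (\<forall>i j. i \<le> j \<longrightarrow> j < length u \<longrightarrow> u ! j \<le> u ! i)"
  unfolding sorted_wrt_iff_nth_less by (metis le_eq_less_or_eq)

text \<open>For \<open>m > 0\<close> a Durfee rectangle of width 0 may reach below the diagram. Then
  \<open>k\<close> exceeds \<open>length l\<close>, and the filter removes the zeros read
  there.\<close>

lemma filter_pos_map_part:
  assumes "is_partition l"
  shows "filter ((<) 0) (map (\<lambda>i. part l (Suc i)) [0..<k] @ drop k l) = l"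
proof -
  have pos: "\<forall>x\<in>set l. 0 < x" using assms by (simp add: is_partition_def)
  have "map (\<lambda>i. part l (Suc i)) [0..<k] = take k l @ replicate (k - length l) 0"
    by (rule nth_equalityI) (auto simp: part_def nth_append)
  moreover have "filter ((<) 0) (take k l) = take k l" "filter ((<) 0) (drop k l) = drop k l"
    "filter ((<) 0) l = l"
    using pos by (auto simp: filter_id_conv dest: in_set_takeD in_set_dropD)
  moreover have "filter ((<) 0) (replicate j 0) = ([] :: nat list)" for j
    by simp
  ultimately show ?thesis by (metis append_Nil2 append_take_drop_id filter_append append.assoc)
qed

section \<open>Durfee rectangles\<close>

text \<open>The bottom row of a taller rectangle lies at or below row \<open>Suc (d + t)\<close>, so
  by monotonicity it is too short. The offset \<open>d\<close> is 0 for the first Durfee rectangle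
  and the height of the first for the second.\<close>

lemma Greatest_rectangle_eq:
  assumes "is_partition l" "max m 1 \<le> t" "t = m \<or> t - m \<le> part l (d + t)"
    and "part l (Suc (d + t)) \<le> t - m"
  shows "(GREATEST t. max m 1 \<le> t \<and> (t = m \<or> part l (d + t) \<ge> t - m)) = t"
proof (rule Greatest_equality)
  fix y assume y: "max m 1 \<le> y \<and> (y = m \<or> part l (d + y) \<ge> y - m)"
  show "y \<le> t"
  proof (rule ccontr)
    assume "\<not> y \<le> t"
    then have "part l (d + y) \<le> part l (Suc (d + t))"
      by (intro part_antimono assms(1)) auto
    with y assms \<open>\<not> y \<le> t\<close> show False by auto
  qed
qed (use assms in auto)

lemma part_below_Greatest_rectangle:
  fixes m d l
  defines "g \<equiv> GREATEST t. max m 1 \<le> t \<and> (t = m \<or> part l (d + t) \<ge> t - m)"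
  assumes "max m 1 \<le> g"
  shows "part l (Suc (d + g)) \<le> g - m"
proof (rule ccontr)
  assume "\<not> ?thesis"
  with assms(2) have "max m 1 \<le> Suc g \<and> (Suc g = m \<or> part l (d + Suc g) \<ge> Suc g - m)"
    by auto
  then have "Suc g \<le> g"
    unfolding g_def by (rule Greatest_le_nat) (rule durfee2_bound)
  then show False by simp
qed

section \<open>Decomposition of a partition\<close>

text \<open>A triple of lists stands for \<open>\<alpha>\<close>, \<open>\<beta>\<close>, \<open>\<gamma>\<close>. The first two are padded with zeros to the
  heights \<open>s\<close>, \<open>t\<close> of the Durfee rectangles, which are thus recovered as lengths.\<close>

type_synonym triple = "nat list \<times> nat list \<times> nat list"

text \<open>The two bounds express maximality of the rectangles: the row just below each one is no
  longer than its width. For the first, \<open>length a - length b\<close> is the difference of the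
  two widths.\<close>

definition durfee_triples :: "nat \<Rightarrow> triple set" where
  "durfee_triples m = {(a, b, c). max m 1 \<le> length b \<and> length b \<le> length a \<and>
     decreasing a \<and> decreasing b \<and> is_partition c \<and>
     (\<forall>x\<in>set b. x \<le> length a - length b) \<and> (\<forall>x\<in>set c. x \<le> length b - m)}"

definition padded_parts :: "nat \<Rightarrow> triple \<Rightarrow> nat list" where
  "padded_parts m = (\<lambda>(a, b, c).
     map ((+) (length a - m)) a @ map ((+) (length b - m)) b @ c)"

definition assemble :: "nat \<Rightarrow> triple \<Rightarrow> nat list" where
  "assemble m x = filter ((<) 0) (padded_parts m x)"

definition triple_size :: "nat \<Rightarrow> triple \<Rightarrow> nat" where
  "triple_size m = (\<lambda>(a, b, c). length a * (length a - m) + sum_list a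
     + (length b * (length b - m) + sum_list b) + sum_list c)"

text \<open>List indices start at 0, which absorbs the \<open>+ 1\<close> in the index used by
  \<open>rank2\<close>.\<close>

definition triple_rank :: "triple \<Rightarrow> int" where
  "triple_rank = (\<lambda>(a, b, c). int (hd b) + int (a ! (length a - length b - hd b)) - int (length c))"

lemma sum_list_map_plus: "sum_list (map ((+) k) u) = length u * k + sum_list (u :: nat list)"
  by (induction u) auto

lemma sum_list_assemble: "sum_list (assemble m x) = triple_size m x"
  by (auto simp: assemble_def padded_parts_def triple_size_def sum_list_filter_pos
      sum_list_map_plus split: prod.splits)

lemma decreasing_padded_parts:
  assumes "x \<in> durfee_triples m"
  shows "decreasing (padded_parts m x)"
proof -
  obtain a b c where x: "x = (a, b, c)" by (cases x)
  have "decreasing (map ((+) k) u)" if "decreasing u" for k and u :: "nat list"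
    using that by (auto simp: sorted_wrt_map elim: sorted_wrt_mono_rel[rotated])
  moreover have "y \<le> length a - m + z" if "y \<in> set c" for y z
    using assms that unfolding x durfee_triples_def by fastforce
  moreover have "length b - m + y \<le> length a - m + z" if "y \<in> set b" for y z
    using assms that unfolding x durfee_triples_def by fastforce
  ultimately show ?thesis
    using assms unfolding x durfee_triples_def padded_parts_def
    by (auto simp: sorted_wrt_append is_partition_def intro: trans_le_add1)
qed

lemma part_assemble: "x \<in> durfee_triples m \<Longrightarrow> part (assemble m x) j = part (padded_parts m x) j"
  unfolding assemble_def by (intro part_filter_pos decreasing_padded_parts)

lemma is_partition_assemble: "x \<in> durfee_triples m \<Longrightarrow> is_partition (assemble m x)"
  unfolding assemble_def by (intro is_partition_filter_pos decreasing_padded_parts)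

context
  fixes m :: nat and a b c :: "nat list"
  assumes abc: "(a, b, c) \<in> durfee_triples m"
begin

lemma part_assemble_alpha:
  "i < length a \<Longrightarrow> part (assemble m (a, b, c)) (Suc i) = length a - m + a ! i"
  unfolding part_assemble[OF abc] by (simp add: padded_parts_def part_nth nth_append)

lemma part_assemble_beta:
  "i < length b \<Longrightarrow> part (assemble m (a, b, c)) (Suc (length a + i)) = length b - m + b ! i"
  unfolding part_assemble[OF abc] by (simp add: padded_parts_def part_nth nth_append)

lemma part_assemble_gamma:
  "part (assemble m (a, b, c)) (Suc (length a + length b + i)) = part c (Suc i)"
  unfolding part_assemble[OF abc] by (simp add: padded_parts_def part_def nth_append)

lemma triple_lengths: "1 \<le> length b" "m \<le> length b" "length b \<le> length a" "b \<noteq> []"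
  using abc by (auto simp: durfee_triples_def)

lemma hd_beta_le: "hd b \<le> length a - length b"
  using abc triple_lengths by (cases b) (auto simp: durfee_triples_def)

lemma nth_0_beta: "b ! 0 = hd b"
  using triple_lengths by (cases b) auto

lemma part_alpha_last: "length a - m \<le> part (assemble m (a, b, c)) (length a)"
proof -
  obtain k where "length a = Suc k" using triple_lengths by (cases "length a") auto
  then show ?thesis using part_assemble_alpha[of k] by simp
qed

lemma part_beta_last: "length b - m \<le> part (assemble m (a, b, c)) (length a + length b)"
proof -
  obtain k where "length b = Suc k" using triple_lengths by (cases "length b") auto
  then show ?thesis using part_assemble_beta[of k] by simp
qed

lemma part_gamma_le: "part c i \<le> length b - m"
  using abc by (auto simp: durfee_triples_def part_def)

lemma part_below_alpha: "part (assemble m (a, b, c)) (Suc (length a)) \<le> length a - m"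
  using part_assemble_beta[of 0] triple_lengths hd_beta_le nth_0_beta by simp

lemma durfee1_assemble: "durfee1 m (assemble m (a, b, c)) = length a"
  unfolding durfee1_def
  using Greatest_rectangle_eq[OF is_partition_assemble[OF abc], of m "length a" 0]
    part_alpha_last triple_lengths part_below_alpha
  by simp

lemma durfee2_assemble: "durfee2 m (assemble m (a, b, c)) = length b"
  unfolding durfee2_def durfee1_assemble
  using Greatest_rectangle_eq[OF is_partition_assemble[OF abc], of m "length b" "length a"]
    part_beta_last triple_lengths part_assemble_gamma[of 0]
    part_gamma_le[of 1]
  by simp

text \<open>For \<open>m = 0\<close> the two squares force at least
  \<open>length a + length b\<close> rows, while the last part is at most the row below the first
  square, hence at most \<open>length a\<close>.\<close>

lemma rank_defined_assemble: "rank_defined m (assemble m (a, b, c))"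
proof (cases "m = 0")
  case True
  let ?l = "assemble m (a, b, c)"
  have "length a + length b \<le> length ?l"
    using part_beta_last triple_lengths True
    by (simp add: part_def split: if_splits)
  moreover have "part ?l (length ?l) \<le> part ?l (Suc (length a))"
    using calculation triple_lengths
    by (intro part_antimono is_partition_assemble abc) auto
  moreover have "last ?l = part ?l (length ?l)" "?l \<noteq> []"
    using calculation(1) triple_lengths by (auto simp: last_conv_nth part_def Suc_le_eq)
  ultimately show ?thesis
    using part_below_alpha triple_lengths True
    by (simp add: rank_defined_def rogers_ramanujan_def)
qed (simp add: rank_defined_def)

lemma rank2_assemble: "rank2 m (assemble m (a, b, c)) = triple_rank (a, b, c)"
proof -
  have beta: "beta m (assemble m (a, b, c)) 1 = hd b"
    using part_assemble_beta[of 0] triple_lengths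
    by (simp add: beta_def durfee1_assemble durfee2_assemble nth_0_beta)
  have i: "length a - length b - hd b < length a"
    using triple_lengths by simp
  have "\<And>i. 0 < i \<Longrightarrow> gamma m (assemble m (a, b, c)) i = part c i"
    using part_assemble_gamma by (auto simp: gamma_def durfee1_assemble durfee2_assemble gr0_conv_Suc)
  then have "{i. gamma m (assemble m (a, b, c)) i \<noteq> 0} = {1..length c}"
    using abc by (auto simp: gamma_def part_def durfee_triples_def is_partition_def
        split: if_splits)
  then show ?thesis
    unfolding rank2_def beta triple_rank_def
    using part_assemble_alpha[OF i] i
    by (simp add: alpha_def durfee1_assemble durfee2_assemble)
qed

end

text \<open>The Durfee heights recover the lengths of the first two lists, and the rows through the
  rectangles recover their entries. Cancelling these rows leaves \<open>c\<close>, which has no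
  zeros for the filter to lose.\<close>

lemma inj_on_assemble: "inj_on (assemble m) (durfee_triples m)"
proof (rule inj_onI)
  fix x x'
  assume x: "x \<in> durfee_triples m" "x' \<in> durfee_triples m" "assemble m x = assemble m x'"
  obtain a b c a' b' c' where abc_eq: "x = (a, b, c)" "x' = (a', b', c')"
    by (cases x; cases x')
  note abc = x(1)[unfolded abc_eq] and abc' = x(2)[unfolded abc_eq] and eq = x(3)[unfolded abc_eq]
  have len: "length a = length a'" "length b = length b'"
    using durfee1_assemble[OF abc] durfee1_assemble[OF abc']
      durfee2_assemble[OF abc] durfee2_assemble[OF abc'] eq by auto
  have a: "a = a'"
    using part_assemble_alpha[OF abc] part_assemble_alpha[OF abc'] eq len
    by (intro nth_equalityI) (auto)
  moreover have b: "b = b'"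
    using part_assemble_beta[OF abc] part_assemble_beta[OF abc'] eq len
    by (intro nth_equalityI) (auto)
  moreover have "filter ((<) 0) c = c" "filter ((<) 0) c' = c'"
    using abc abc' by (auto simp: durfee_triples_def is_partition_def filter_id_conv)
  ultimately show "x = x'"
    using eq by (simp add: abc_eq assemble_def padded_parts_def)
qed

lemma assemble_surj:
  assumes l: "is_partition l" and def: "rank_defined m l"
  shows "l \<in> assemble m ` durfee_triples m"
proof -
  define s t where "s = durfee1 m l" and "t = durfee2 m l"
  define a where "a = map (\<lambda>i. alpha m l (Suc i)) [0..<s]"
  define b where "b = map (\<lambda>i. beta m l (Suc i)) [0..<t]"
  define c where "c = drop (s + t) l"
  note anti = part_antimono[OF l]
  have s: "max m 1 \<le> s" and t: "max m 1 \<le> t"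
    using durfee1_props[OF l def] durfee2_props[OF l def] by (auto simp: s_def t_def)
  have ts: "t \<le> s" using rank_index_exact[OF l def] by (simp add: s_def t_def)
  have s_below: "part l (Suc s) \<le> s - m"
    using part_below_Greatest_rectangle[of m l 0] s by (simp add: s_def durfee1_def)
  have t_below: "part l (Suc (s + t)) \<le> t - m"
    using part_below_Greatest_rectangle[of m l s] t by (simp add: s_def t_def durfee2_def)
  have len: "length a = s" "length b = t" by (simp_all add: a_def b_def)
  have nth_a: "a ! i = part l (Suc i) - (s - m)" if "i < s" for i
    using that by (simp add: a_def alpha_def s_def)
  have nth_b: "b ! i = part l (Suc (s + i)) - (t - m)" if "i < t" for i
    using that by (simp add: b_def beta_def s_def t_def)
  have "decreasing a" "decreasing b"
    unfolding decreasing_iff_nth len by (auto simp: nth_a nth_b intro!: diff_le_mono anti)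
  moreover have "x \<le> s - t" if x: "x \<in> set b" for x
  proof -
    obtain i where "i < t" "x = b ! i"
      using x by (auto simp: in_set_conv_nth len)
    moreover have "part l (Suc (s + i)) \<le> part l (Suc s)" by (rule anti) auto
    ultimately show ?thesis using s_below t nth_b by simp
  qed
  moreover have "x \<le> t - m" if x: "x \<in> set c" for x
  proof -
    obtain i where "i < length l - (s + t)" "x = l ! (s + t + i)"
      using x by (auto simp: c_def in_set_conv_nth)
    moreover from this have "x = part l (Suc (s + t + i))" by (auto simp: part_def)
    moreover have "part l (Suc (s + t + i)) \<le> part l (Suc (s + t))" by (rule anti) auto
    ultimately show ?thesis using t_below by simp
  qed
  moreover have "is_partition c"
    using l by (auto simp: c_def is_partition_def sorted_wrt_drop dest: in_set_dropD)
  ultimately have "(a, b, c) \<in> durfee_triples m"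
    using s t ts by (auto simp: durfee_triples_def len)
  \<comment> \<open>Adding the widths back undoes the subtractions in \<open>alpha\<close> and
    \<open>beta\<close>, because neither truncates.\<close>
  moreover have "map ((+) (s - m)) a @ map ((+) (t - m)) b = map (\<lambda>i. part l (Suc i)) [0..<s + t]"
  proof (rule nth_equalityI)
    fix i assume "i < length (map ((+) (s - m)) a @ map ((+) (t - m)) b)"
    then have i: "i < s + t" by (simp add: len)
    show "(map ((+) (s - m)) a @ map ((+) (t - m)) b) ! i = map (\<lambda>i. part l (Suc i)) [0..<s + t] ! i"
    proof (cases "i < s")
      case True
      with alpha_exact(2)[OF l def, of "Suc i"] show ?thesis
        by (simp add: nth_append len nth_a s_def)
    next
      case False
      with i beta_exact(2)[OF l def, of "Suc (i - s)"] show ?thesis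
        by (simp add: nth_append len nth_b s_def t_def)
    qed
  qed (simp add: len)
  then have "assemble m (a, b, c) = l"
    using filter_pos_map_part[OF l, of "s + t"]
    unfolding assemble_def padded_parts_def c_def by (simp add: len del: filter_append map_append upt_add_eq_append) (metis append.assoc)
  ultimately show ?thesis by (metis imageI)
qed

text \<open>Counting moves from partitions to triples; an arbitrary \<open>P\<close> serves both
  rank inequalities.\<close>

lemma card_rank2_eq_card_triples:
  "card {l \<in> partitions_of n. rank_defined m l \<and> P (rank2 m l)} =
   card {x \<in> durfee_triples m. int (triple_size m x) = n \<and> P (triple_rank x)}"
proof -
  let ?X = "{x \<in> durfee_triples m. int (triple_size m x) = n \<and> P (triple_rank x)}"
  have "{l \<in> partitions_of n. rank_defined m l \<and> P (rank2 m l)} = assemble m ` ?X"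
    using assemble_surj
    by (fastforce simp: partitions_of_def is_partition_assemble sum_list_assemble
        rank_defined_assemble rank2_assemble)
  moreover have "inj_on (assemble m) ?X"
    using inj_on_assemble by (rule inj_on_subset) auto
  ultimately show ?thesis by (simp add: card_image)
qed

section \<open>Adding and removing the first column\<close>

definition add_column :: "nat \<Rightarrow> nat list \<Rightarrow> nat list" where
  "add_column d c = map Suc c @ replicate (d - length c) 1"

definition remove_column :: "nat list \<Rightarrow> nat list" where
  "remove_column c = filter ((<) 0) (map (\<lambda>x. x - 1) c)"

lemma length_add_column: "length c \<le> d \<Longrightarrow> length (add_column d c) = d"
  by (simp add: add_column_def)

lemma sum_list_add_column: "length c \<le> d \<Longrightarrow> sum_list (add_column d c) = sum_list c + d"
proof -
  have "sum_list (map Suc c) = sum_list c + length c" by (induction c) auto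
  then show "length c \<le> d \<Longrightarrow> sum_list (add_column d c) = sum_list c + d"
    by (simp add: add_column_def sum_list_replicate)
qed

lemma decreasing_replicate: "decreasing (replicate k x)"
  by (induction k) auto

lemma is_partition_add_column: "is_partition c \<Longrightarrow> is_partition (add_column d c)"
  using decreasing_replicate
  by (auto simp: is_partition_def add_column_def sorted_wrt_append sorted_wrt_map)

lemma length_remove_column_le: "length (remove_column c) \<le> length c"
  unfolding remove_column_def by (metis length_filter_le length_map)

lemma remove_column_add_column: "is_partition c \<Longrightarrow> remove_column (add_column d c) = c"
  by (auto simp: remove_column_def add_column_def is_partition_def o_def filter_id_conv)

lemma add_column_remove_column: "is_partition c \<Longrightarrow> add_column (length c) (remove_column c) = c"
proof (induction c)
  case (Cons x c)
  then have c: "is_partition c" and x: "0 < x" "\<forall>y\<in>set c. y \<le> x \<and> 0 < y"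
    by (auto simp: is_partition_def)
  show ?case
  proof (cases "x = 1")
    case True
    \<comment> \<open>Here removing the column erases every row, and the padding in
      \<open>add_column\<close> restores them all.\<close>
    with x have ones: "\<forall>y\<in>set (x # c). y = 1" by (fastforce intro: antisym)
    then have "remove_column (x # c) = []"
      by (auto simp: remove_column_def filter_empty_conv)
    moreover have "replicate (length (x # c)) 1 = x # c"
      using ones by (metis replicate_length_same)
    ultimately show ?thesis
      unfolding add_column_def by (simp only: list.map append_Nil list.size(3) diff_zero)
  next
    case False
    with x Cons.IH[OF c] show ?thesis by (simp add: add_column_def remove_column_def)
  qed
qed (simp add: add_column_def remove_column_def)

lemma is_partition_remove_column: "is_partition c \<Longrightarrow> is_partition (remove_column c)"
  unfolding remove_column_def
  by (intro is_partition_filter_pos)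
    (auto simp: is_partition_def sorted_wrt_map elim!: sorted_wrt_mono_rel[rotated])

section \<open>Deleting and inserting a part\<close>

definition delete_nth :: "nat \<Rightarrow> 'a list \<Rightarrow> 'a list" where
  "delete_nth i u = take i u @ drop (Suc i) u"

definition insert_nth :: "nat \<Rightarrow> 'a \<Rightarrow> 'a list \<Rightarrow> 'a list" where
  "insert_nth i x u = take i u @ x # drop i u"

lemma length_delete_nth: "i < length u \<Longrightarrow> length (delete_nth i u) = length u - 1"
  by (simp add: delete_nth_def)

lemma nth_delete_nth:
  "i < length u \<Longrightarrow> j < length u - 1 \<Longrightarrow> delete_nth i u ! j = (if j < i then u ! j else u ! Suc j)"
  by (auto simp: delete_nth_def nth_append)

lemma insert_nth_delete_nth: "i < length u \<Longrightarrow> insert_nth i (u ! i) (delete_nth i u) = u"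
  by (simp add: delete_nth_def insert_nth_def id_take_nth_drop[symmetric])

lemma delete_nth_insert_nth: "i \<le> length u \<Longrightarrow> delete_nth i (insert_nth i x u) = u"
  by (simp add: delete_nth_def insert_nth_def)

lemma sum_list_delete_nth:
  fixes u :: "nat list"
  assumes "i < length u"
  shows "sum_list (delete_nth i u) + u ! i = sum_list u"
proof -
  have "sum_list u = sum_list (take i u @ u ! i # drop (Suc i) u)"
    using id_take_nth_drop[OF assms] by simp
  then show ?thesis by (simp add: delete_nth_def)
qed

lemma decreasing_delete_nth:
  assumes "i < length u" "decreasing u"
  shows "decreasing (delete_nth i u)"
  using assms unfolding decreasing_iff_nth
  by (simp add: length_delete_nth nth_delete_nth)

lemma decreasing_insert_nth:
  assumes "decreasing u" "\<forall>y\<in>set (take i u). x \<le> y" "\<forall>y\<in>set (drop i u). y \<le> x"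
  shows "decreasing (insert_nth i x u)"
proof -
  have "\<forall>y\<in>set (take i u). \<forall>z\<in>set (drop i u). z \<le> y"
    using assms by force
  then show ?thesis
    using assms by (auto simp: insert_nth_def sorted_wrt_append sorted_wrt_take sorted_wrt_drop)
qed

section \<open>The bijection\<close>

text \<open>This is the inverse direction, from parameter \<open>m + 2\<close> to \<open>m\<close>.
  The index \<open>i\<close> is where the rank of the argument reads \<alpha>.\<close>

definition transfer_parts :: "nat \<Rightarrow> triple \<Rightarrow> triple" where
  "transfer_parts r = (\<lambda>(a, b, c). let i = length a - length b - hd b in
     (delete_nth i a, tl b, add_column (r + hd b + a ! i) c))"

text \<open>Each rectangle gains area \<open>m + 1\<close>, since (s-1)(s-1-m) - s(s-m-2) = m+1, and
  the new column holds the two deleted parts plus \<open>r\<close>. The rank bound holds because the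
  parts now seen by the rank are at most the deleted ones.\<close>

lemma transfer_parts_triple:
  assumes x: "x \<in> durfee_triples (m + 2)" and rank: "triple_rank x \<ge> - int r"
  shows "transfer_parts r x \<in> durfee_triples m"
    and "triple_rank (transfer_parts r x) \<le> - int r"
    and "triple_size m (transfer_parts r x) = triple_size (m + 2) x + r + 2 * m + 2"
proof -
  obtain a b0 c where x_eq0: "x = (a, b0, c)" by (cases x)
  with x obtain k b where b0: "b0 = k # b" by (cases b0) (auto simp: durfee_triples_def)
  note x_eq = x_eq0[unfolded b0]
  define i where "i = length a - length (k # b) - k"
  define d where "d = r + k + a ! i"
  have image: "transfer_parts r x = (delete_nth i a, b, add_column d c)"
    by (simp add: x_eq transfer_parts_def i_def d_def Let_def)
  have b: "m + 1 \<le> length b" and ab: "Suc (length b) \<le> length a"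
    and dec: "decreasing a" "decreasing b" "\<forall>y\<in>set b. y \<le> k"
    and c: "is_partition c"
    and k: "k \<le> length a - Suc (length b)"
    and c_le: "\<forall>y\<in>set c. y \<le> length b - Suc m"
    using x unfolding x_eq durfee_triples_def by auto
  have i: "i < length a" using ab by (simp add: i_def)
  \<comment> \<open>The rank hypothesis says exactly that the new column is at least as tall as
    \<open>c\<close>.\<close>
  have d: "length c \<le> d"
    using rank by (simp add: x_eq triple_rank_def d_def i_def)
  have col: "length (add_column d c) = r + k + a ! i"
    "sum_list (add_column d c) = sum_list c + (r + k + a ! i)"
    using d by (simp_all add: length_add_column sum_list_add_column d_def)
  have len: "length (delete_nth i a) = length a - 1"
    using i by (rule length_delete_nth)
  have "y \<le> length b - m" if "y \<in> set (add_column d c)" for y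
    using that c_le b by (fastforce simp: add_column_def)
  then show "transfer_parts r x \<in> durfee_triples m"
    using b ab k dec decreasing_delete_nth[OF i dec(1)] is_partition_add_column[OF c]
    by (fastforce simp: image durfee_triples_def len)
  have "hd b \<le> k" using b dec(3) by (cases b) auto
  \<comment> \<open>The rank of the image reads \<alpha> at or after the deleted position, so it
    finds an entry that followed \<open>a ! i\<close>.\<close>
  then have ij: "i \<le> length a - 1 - length b - hd b" using k by (simp add: i_def)
  have j: "length a - 1 - length b - hd b < length a - 1" using b ab by (cases b) auto
  have "delete_nth i a ! (length a - 1 - length b - hd b) \<le> a ! i"
    using dec(1) ij j by (simp add: nth_delete_nth[OF i] decreasing_iff_nth)
  with \<open>hd b \<le> k\<close> show "triple_rank (transfer_parts r x) \<le> - int r"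
    by (simp add: image triple_rank_def len col)
  \<comment> \<open>Writing the lengths as sums eliminates the truncated subtractions before the
    algebra.\<close>
  obtain p where p: "length b = m + 1 + p" using b by (metis le_iff_add)
  moreover obtain q where q: "length a = length b + 1 + q" using ab by (metis Suc_eq_plus1 le_iff_add)
  ultimately show "triple_size m (transfer_parts r x) = triple_size (m + 2) x + r + 2 * m + 2"
    using sum_list_delete_nth[OF i]
    unfolding image by (simp add: x_eq triple_size_def len col algebra_simps)
qed

text \<open>The height of the new column fixes the sum of the two deleted parts. If their two ways of
  splitting differ, the one with the larger part of \<open>\<beta>\<close> deletes a smaller part of \<open>\<alpha>\<close> at an earlier
  position, which is incompatible with monotonicity of \<open>\<alpha>\<close>.\<close>

lemma transfer_parts_inj_aux:
  assumes x: "(a, k # b, c) \<in> durfee_triples M" "(a', k' # b, c') \<in> durfee_triples M"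
    and len: "length a = length a'"
    and sum: "k + a ! (length a - Suc (length b) - k) = k' + a' ! (length a' - Suc (length b) - k')"
    and del: "delete_nth (length a - Suc (length b) - k) a = delete_nth (length a' - Suc (length b) - k') a'"
  shows "k' \<le> k"
proof (rule ccontr)
  assume "\<not> k' \<le> k"
  define i i' where "i = length a - Suc (length b) - k" and "i' = length a' - Suc (length b) - k'"
  have k: "k' \<le> length a - Suc (length b)" and ab: "Suc (length b) \<le> length a"
    and dec: "decreasing a" "decreasing a'"
    using x len by (auto simp: durfee_triples_def)
  have ii: "i' < i" "i < length a" "i' < length a'"
    using \<open>\<not> k' \<le> k\<close> k ab len by (auto simp: i_def i'_def)
  have "a ! i' = delete_nth i a ! i'" using ii by (simp add: nth_delete_nth)
  also have "\<dots> = delete_nth i' a' ! i'" using del by (simp add: i_def i'_def)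
  also have "\<dots> = a' ! Suc i'" using ii len by (simp add: nth_delete_nth)
  also have "\<dots> \<le> a' ! i'" using dec(2) ii len by (simp add: decreasing_iff_nth)
  finally have "a ! i' \<le> a' ! i'" .
  moreover have "a ! i \<le> a ! i'" using dec(1) ii by (simp add: decreasing_iff_nth)
  moreover have "k + a ! i = k' + a' ! i'" using sum by (simp add: i_def i'_def)
  ultimately show False using \<open>\<not> k' \<le> k\<close> by simp
qed

text \<open>The column height gives the sum of the deleted parts, and removing the column gives
  \<open>c\<close>. Applying the preceding lemma both ways identifies the deleted part of \<beta>,
  hence also the position and value to reinsert in \<alpha>.\<close>

lemma inj_on_transfer_parts:
  "inj_on (transfer_parts r) {x \<in> durfee_triples (m + 2). triple_rank x \<ge> - int r}"
proof (rule inj_onI)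
  fix y y'
  assume y: "y \<in> {x \<in> durfee_triples (m + 2). triple_rank x \<ge> - int r}"
    "y' \<in> {x \<in> durfee_triples (m + 2). triple_rank x \<ge> - int r}"
    "transfer_parts r y = transfer_parts r y'"
  obtain a k b c where y_eq: "y = (a, k # b, c)"
    using y(1) by (cases y; cases "fst (snd y)") (auto simp: durfee_triples_def)
  obtain a' k' b' c' where y'_eq: "y' = (a', k' # b', c')"
    using y(2) by (cases y'; cases "fst (snd y')") (auto simp: durfee_triples_def)
  have x: "(a, k # b, c) \<in> durfee_triples (m + 2)" "(a', k' # b', c') \<in> durfee_triples (m + 2)"
    and rank: "triple_rank (a, k # b, c) \<ge> - int r" "triple_rank (a', k' # b', c') \<ge> - int r"
    and eq: "transfer_parts r (a, k # b, c) = transfer_parts r (a', k' # b', c')"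
    using y by (simp_all add: y_eq y'_eq)
  define i i' where "i = length a - Suc (length b) - k" and "i' = length a' - Suc (length b') - k'"
  have del: "delete_nth i a = delete_nth i' a'" and b: "b = b'"
    and col: "add_column (r + k + a ! i) c = add_column (r + k' + a' ! i') c'"
    using eq by (auto simp: transfer_parts_def i_def i'_def Let_def)
  have i: "i < length a" "i' < length a'" and c: "is_partition c" "is_partition c'"
    using x by (auto simp: durfee_triples_def i_def i'_def)
  have len: "length a = length a'"
    using arg_cong[OF del, of length] i by (simp add: length_delete_nth)
  have "length c \<le> r + k + a ! i" "length c' \<le> r + k' + a' ! i'"
    using rank by (simp_all add: triple_rank_def i_def i'_def)
  then have sum: "k + a ! i = k' + a' ! i'"
    using arg_cong[OF col, of length] by (simp add: length_add_column)
  have "c = c'"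
    using arg_cong[OF col, of remove_column] c by (simp add: remove_column_add_column)
  have "k' \<le> k" "k \<le> k'"
    using transfer_parts_inj_aux[of a k b c "m + 2" a' k' c']
      transfer_parts_inj_aux[of a' k' b c' "m + 2" a k c] x len sum del
    by (simp_all add: b i_def i'_def)
  then have "k = k'" by simp
  moreover have "i = i'" using b len \<open>k = k'\<close> by (simp add: i_def i'_def)
  moreover have "a = a'"
    using insert_nth_delete_nth[OF i(1)] insert_nth_delete_nth[OF i(2)] del sum
      \<open>k = k'\<close> \<open>i = i'\<close> by (metis add_left_cancel)
  ultimately show "y = y'"
    using b \<open>c = c'\<close> \<open>k = k'\<close> by (simp add: y_eq y'_eq)
qed

lemma transfer_parts_surj:
  assumes pos: "m = 0 \<or> 0 < r"
    and y: "y \<in> durfee_triples m" and rank: "triple_rank y \<le> - int r"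
  shows "y \<in> transfer_parts r ` {x \<in> durfee_triples (m + 2). triple_rank x \<ge> - int r}"
proof -
  obtain a b c where y_eq: "y = (a, b, c)" by (cases y)
  note lens = triple_lengths[OF y[unfolded y_eq]]
  note hd_le = hd_beta_le[OF y[unfolded y_eq]]
  have dec: "decreasing a" "decreasing b" and c: "is_partition c"
    and c_le: "\<forall>z\<in>set c. z \<le> length b - m"
    and b_le: "\<forall>z\<in>set b. z \<le> length a - length b"
    using y by (auto simp: y_eq durfee_triples_def)
  \<comment> \<open>If \<open>j\<close> becomes the new largest part of \<beta>, the remainder
    \<open>length c - r - j\<close> goes into \<alpha> at index
    \<open>length a - length b - j\<close>. It must be at least the entry it pushes down.\<close>
  define fits where
    "fits j \<longleftrightarrow> j \<le> length a - length b \<and> r + j + a ! (length a - length b - j) \<le> length c" for j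
  \<comment> \<open>Maximality of \<open>k\<close> forces the complementary part \<open>x\<close> of \<open>\<alpha>\<close> to land exactly at index \<open>i\<close>.\<close>
  define k where "k = (GREATEST j. fits j)"
  \<comment> \<open>This is the rank hypothesis. It makes \<open>k\<close> at least
    \<open>hd b\<close>, so \<open>k # b\<close> stays decreasing.\<close>
  have fits_hd: "fits (hd b)"
    using rank hd_le by (simp add: fits_def y_eq triple_rank_def)
  have bound: "fits j \<Longrightarrow> j \<le> length a - length b" for j by (simp add: fits_def)
  have k: "fits k" unfolding k_def by (rule GreatestI_nat[of fits, OF fits_hd bound])
  have hd_k: "hd b \<le> k" unfolding k_def by (rule Greatest_le_nat[of fits, OF fits_hd bound])
  have "\<not> fits (Suc k)" using Greatest_le_nat[of fits "Suc k", OF _ bound] by (auto simp: k_def)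
  define i where "i = length a - length b - k"
  define x where "x = length c - r - k"
  have i_eq: "length a - (length b + k) = i" by (simp add: i_def)
  have i: "i < length a" using lens by (simp add: i_def)
  have x: "r + k + x = length c" "a ! i \<le> x" using k by (auto simp: fits_def x_def i_def)
  \<comment> \<open>For \<open>0 < i\<close> the candidate \<open>Suc k\<close> is within range, so
    it fails only because \<open>r + Suc k + a ! (i - 1)\<close> exceeds
    \<open>r + k + x\<close>.\<close>
  have x_le: "x \<le> a ! (i - 1)" if "0 < i"
    using \<open>\<not> fits (Suc k)\<close> that x(1) by (auto simp: fits_def i_def)
  have take: "\<forall>z\<in>set (take i a). x \<le> z"
  proof
    fix z assume "z \<in> set (take i a)"
    then obtain j where "j < i" "z = a ! j" using i by (auto simp: in_set_conv_nth)
    moreover have "a ! (i - 1) \<le> a ! j"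
      using dec(1) i \<open>j < i\<close> by (simp add: decreasing_iff_nth)
    ultimately show "x \<le> z" using x_le by simp
  qed
  have drop: "\<forall>z\<in>set (drop i a). z \<le> x"
  proof
    fix z assume "z \<in> set (drop i a)"
    then obtain j where "j < length a - i" "z = a ! (i + j)" by (auto simp: in_set_conv_nth)
    moreover have "a ! (i + j) \<le> a ! i"
      using dec(1) calculation(1) by (simp add: decreasing_iff_nth)
    ultimately show "z \<le> x" using x(2) by simp
  qed
  \<comment> \<open>The new second rectangle has width \<open>length b - m - 1\<close>, so the old
    one must have positive width. For \<open>m > 0\<close> this follows from \<open>r > 0\<close>:
    then \<open>c\<close> is nonempty and its positive parts are bounded by that width.\<close>
  have "m < length b"
  proof (cases "m = 0")
    case False
    with pos x(1) obtain z where "z \<in> set c" by (cases c) auto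
    with c_le c show ?thesis by (fastforce simp: is_partition_def)
  qed (use lens in simp)
  let ?x = "(insert_nth i x a, k # b, remove_column c)"
  have len: "length (insert_nth i x a) = Suc (length a)" using i by (simp add: insert_nth_def)
  have nth: "insert_nth i x a ! i = x" using i by (simp add: insert_nth_def nth_append)
  have "z \<le> length b - Suc m" if "z \<in> set (remove_column c)" for z
    using that c_le by (auto simp: remove_column_def)
  moreover have "z \<le> hd b" if "z \<in> set b" for z
    using dec(2) that by (cases b) auto
  ultimately have "?x \<in> durfee_triples (m + 2)"
    using lens k b_le hd_k \<open>m < length b\<close> decreasing_insert_nth[OF dec(1) take drop] dec(2)
      is_partition_remove_column[OF c]
    by (auto simp: durfee_triples_def len fits_def intro: order_trans)
  moreover have "triple_rank ?x \<ge> - int r"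
    using length_remove_column_le[of c] x(1) by (simp add: triple_rank_def len i_eq nth)
  moreover have "transfer_parts r ?x = y"
    using i x(1) add_column_remove_column[OF c]
    by (simp add: transfer_parts_def len nth y_eq delete_nth_insert_nth i_eq)
  ultimately show ?thesis by (metis (mono_tags, lifting) image_eqI mem_Collect_eq)
qed

theorem mainTheorem3:
  fixes m :: nat and r n :: int
  assumes "(m > 0 \<and> r > 0) \<or> (m = 0 \<and> r \<ge> 0)"
    and "n \<ge> 1"
  shows "h_le n m (- r) = h_ge (n - r - 2 * int m - 2) (m + 2) (- r)"
proof -
  define q where "q = nat r"
  have r: "r = int q" and pos: "m = 0 \<or> 0 < q" using assms(1) by (auto simp: q_def)
  let ?X = "{x \<in> durfee_triples (m + 2).
    int (triple_size (m + 2) x) = n - r - 2 * int m - 2 \<and> triple_rank x \<ge> - r}"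
  let ?Y = "{x \<in> durfee_triples m. int (triple_size m x) = n \<and> triple_rank x \<le> - r}"
  \<comment> \<open>Sizes are compared as integers, so a negative target size makes
    \<open>?X\<close> empty and needs no separate case.\<close>
  have "?Y = transfer_parts q ` ?X"
  proof (intro equalityI subsetI)
    fix y assume y: "y \<in> ?Y"
    then obtain x where x: "x \<in> durfee_triples (m + 2)" "triple_rank x \<ge> - r" "y = transfer_parts q x"
      using transfer_parts_surj[OF pos, of y] unfolding r by auto
    moreover from this y have "x \<in> ?X"
      using transfer_parts_triple(3)[of x m q] unfolding r by auto
    ultimately show "y \<in> transfer_parts q ` ?X" by blast
  next
    fix y assume "y \<in> transfer_parts q ` ?X"
    then show "y \<in> ?Y" using transfer_parts_triple[of _ m q] unfolding r by auto
  qed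
  moreover have "inj_on (transfer_parts q) ?X"
    using inj_on_transfer_parts by (rule inj_on_subset) (auto simp: r)
  ultimately have "card ?Y = card ?X" by (simp add: card_image)
  then show ?thesis
    unfolding h_le_def h_ge_def by (simp add: card_rank2_eq_card_triples[where P = "\<lambda>x. x \<le> - r"]
        card_rank2_eq_card_triples[where P = "\<lambda>x. - r \<le> x"])
qed

end
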